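(* Let $n\in\mathbb{N}$ and let $F\in\mathbb{R}[x_1,\ldots,x_n]$ be a symmetric polynomial of degree $d$. Then there is $x\in\mathbb{R}^n$ with $F(x)=0$ if and only if there is $y\in A_d$ with $F(y)=0$.
   Context: A polynomial $F\in\mathbb{R}[x_1,\ldots,x_n]$ is symmetric if $F(x_{\sigma(1)},\ldots,x_{\sigma(n)})=F(x_1,\ldots,x_n)$ for every permutation $\sigma$ in the symmetric group $S_n$. For $x\in\mathbb{R}^n$ let $n(x)=\#\{x_1,\ldots,x_n\}$ be the number of distinct components of $x$. For $d\in\mathbb{N}$, $A_d:=\{x\in\mathbb{R}^n : n(x)\le d\}$. *)

theory Defs
  imports "HOL-Analysis.Analysis" "HOL-Library.Poly_Mapping"
begin

text \<open>The ring \<open>\<real>[x\<^sub>1, \<dots>, x\<^sub>n]\<close> is the monoid algebra over the exponent vectors \<open>'n \<Rightarrow>\<^sub>0 nat\<close>, with the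
  variables indexed by a finite type \<open>'n\<close> that has \<open>n\<close> elements.\<close>

type_synonym ('n, 'c) mpoly = "('n \<Rightarrow>\<^sub>0 nat) \<Rightarrow>\<^sub>0 'c"

definition Const :: "'c \<Rightarrow> ('n, 'c::zero) mpoly" where
  "Const c = Poly_Mapping.single 0 c"

definition Var :: "'n \<Rightarrow> ('n, 'c::zero_neq_one) mpoly" where
  "Var i = Poly_Mapping.single (Poly_Mapping.single i 1) 1"

text \<open>\<open>mpoly_subst h a F\<close> replaces each variable \<open>x\<^sub>i\<close> of \<open>F\<close> by \<open>a i\<close>; the coefficients are carried
  into the target ring by \<open>h\<close>.\<close>

definition mpoly_subst ::
  "('c \<Rightarrow> 'r) \<Rightarrow> ('n \<Rightarrow> 'r) \<Rightarrow> ('n::finite, 'c::zero) mpoly \<Rightarrow> 'r::comm_semiring_1" where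
  "mpoly_subst h a F = (\<Sum>m\<in>Poly_Mapping.keys F.
     h (Poly_Mapping.lookup F m) * (\<Prod>i\<in>UNIV. a i ^ Poly_Mapping.lookup m i))"

definition mpoly_eval :: "('n::finite, real) mpoly \<Rightarrow> real ^ 'n \<Rightarrow> real" where
  "mpoly_eval F x = mpoly_subst (\<lambda>c. c) (\<lambda>i. x $ i) F"

text \<open>An identity of polynomials, not of polynomial functions.\<close>

definition symmetric_mpoly :: "('n::finite, real) mpoly \<Rightarrow> bool" where
  "symmetric_mpoly F \<longleftrightarrow> (\<forall>\<sigma>. \<sigma> permutes UNIV \<longrightarrow> mpoly_subst Const (\<lambda>i. Var (\<sigma> i)) F = F)"

text \<open>The zero polynomial gets the junk value \<open>0\<close>.\<close>

definition total_degree :: "('n::finite, 'c::zero) mpoly \<Rightarrow> nat" where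
  "total_degree F = (if F = 0 then 0
     else Max ((\<lambda>m. \<Sum>i\<in>UNIV. Poly_Mapping.lookup m i) ` Poly_Mapping.keys F))"

definition num_distinct :: "real ^ 'n \<Rightarrow> nat" where
  "num_distinct x = card {x $ i | i. i \<in> UNIV}"

definition A_set :: "nat \<Rightarrow> (real ^ 'n) set" where
  "A_set d = {x. num_distinct x \<le> d}"

end

theory Submission
  imports Defs "HOL-Computational_Algebra.Polynomial_FPS"
begin

text \<open>\<open>F(x)\<close> depends only on the power sums \<open>p\<^sub>0, \<dots>, p\<^sub>d\<close> of \<open>x\<close>: average \<open>F\<close> over all permutations and
  rewrite each sum over injections recursively. So fix \<open>p\<^sub>1, \<dots>, p\<^sub>d\<close> and, for \<open>d \<ge> 2\<close>, maximise \<open>p\<^bsub>d+1\<^esub>\<close> on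
  the resulting compact set. If a maximiser had \<open>k > d\<close> distinct components \<open>a\<close>, one could add a small
  negative multiple of \<open>t\<^bsup>k-d-1\<^esup>\<close> to \<open>\<Prod>(t - a)\<close>: simple real roots persist, and moving one representative
  of each component to the new roots changes only the elementary symmetric functions from degree \<open>d+1\<close>
  on. By Newton's identities this keeps \<open>p\<^sub>1, \<dots>, p\<^sub>d\<close> and increases \<open>p\<^bsub>d+1\<^esub>\<close>, a contradiction.\<close>

section \<open>Sums of monomials over injections\<close>

text \<open>Splitting off \<open>j\<close>: the rest of an injection is an injection on
  \<open>I\<close>, and the value at \<open>j\<close> may be anything outside its image.\<close>

lemma sum_inj_extend:
  fixes g :: "('a \<Rightarrow> 'b::finite) \<Rightarrow> 'b \<Rightarrow> 'c::comm_monoid_add"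
  assumes "finite I" and "j \<notin> I"
  shows "(\<Sum>f | f \<in> insert j I \<rightarrow>\<^sub>E UNIV \<and> inj_on f (insert j I). g (restrict f I) (f j)) =
    (\<Sum>f | f \<in> I \<rightarrow>\<^sub>E UNIV \<and> inj_on f I. \<Sum>v \<in> - f ` I. g f v)"
proof -
  let ?A = "{f. f \<in> I \<rightarrow>\<^sub>E (UNIV :: 'b set) \<and> inj_on f I}"
  have fin: "finite ?A"
    by (rule finite_subset[of _ "I \<rightarrow>\<^sub>E UNIV"]) (auto intro!: finite_PiE assms)
  have "(\<Sum>f\<in>?A. \<Sum>v \<in> - f ` I. g f v) = (\<Sum>(f, v) \<in> Sigma ?A (\<lambda>f. - f ` I). g f v)"
    by (rule sum.Sigma) (use fin in auto)
  also have "\<dots> = (\<Sum>f | f \<in> insert j I \<rightarrow>\<^sub>E UNIV \<and> inj_on f (insert j I). g (restrict f I) (f j))"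
  proof (rule sum.reindex_bij_witness[where i = "\<lambda>f. (restrict f I, f j)" and j = "\<lambda>(f, v). f(j := v)"],
      goal_cases)
    case (1 a)
    then show ?case using assms
      by (auto simp: PiE_def extensional_def restrict_def fun_eq_iff)
  next
    case (2 a)
    obtain f v where a: "a = (f, v)"
      by (cases a)
    with 2 have f: "f \<in> I \<rightarrow>\<^sub>E UNIV" "inj_on f I" and v: "v \<notin> f ` I"
      by auto
    have "inj_on (f(j := v)) I"
      using f(2) v by (rule inj_on_fun_updI)
    moreover have "(f(j := v)) ` (I - {j}) = f ` I"
      using assms(2) by auto
    ultimately have "inj_on (f(j := v)) (insert j I)"
      unfolding inj_on_insert using v by (metis fun_upd_same)
    moreover have "f(j := v) \<in> insert j I \<rightarrow>\<^sub>E UNIV"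
      using f(1) by (intro PiE_fun_upd) auto
    ultimately show ?case
      by (simp only: a case_prod_conv mem_Collect_eq simp_thms)
  next
    case (3 f)
    then show ?case using assms
      by (auto simp: PiE_def extensional_def restrict_def fun_eq_iff)
  next
    case (4 f)
    then show ?case using assms
      by (auto simp: PiE_def extensional_def)
  next
    case (5 a)
    have "restrict ((fst a)(j := snd a)) I = fst a"
      using 5 assms by (auto simp: PiE_def extensional_def restrict_def fun_eq_iff)
    then show ?case
      by (auto simp: case_prod_beta)
  qed
  finally show ?thesis by simp
qed

text \<open>The value \<open>v\<close> at \<open>j\<close> runs over everything except the
  \<open>f l\<close> with \<open>l\<close> in \<open>I\<close>. The unrestricted sum over
  \<open>v\<close> splits off a power sum; in the excluded case \<open>v = f l\<close> the factor of
  \<open>j\<close> merges into that of \<open>l\<close> and the exponents add.\<close>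

lemma inj_monomial_sum_insert:
  fixes x :: "'b::finite \<Rightarrow> 'c::comm_ring_1"
  assumes "finite I" and "j \<notin> I"
  shows "(\<Sum>f | f \<in> insert j I \<rightarrow>\<^sub>E UNIV \<and> inj_on f (insert j I). \<Prod>i\<in>insert j I. x (f i) ^ m i) =
    (\<Sum>v\<in>UNIV. x v ^ m j) * (\<Sum>f | f \<in> I \<rightarrow>\<^sub>E UNIV \<and> inj_on f I. \<Prod>i\<in>I. x (f i) ^ m i) -
    (\<Sum>l\<in>I. \<Sum>f | f \<in> I \<rightarrow>\<^sub>E UNIV \<and> inj_on f I. \<Prod>i\<in>I. x (f i) ^ (m(l := m l + m j)) i)"
proof -
  let ?A = "{f. f \<in> I \<rightarrow>\<^sub>E (UNIV :: 'b set) \<and> inj_on f I}"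
  let ?P = "\<lambda>f. \<Prod>i\<in>I. x (f i) ^ m i"
  have merge: "x (f l) ^ m j * ?P f = (\<Prod>i\<in>I. x (f i) ^ (m(l := m l + m j)) i)" if "l \<in> I" for f l
    using assms(1) that by (simp add: prod.remove[of I l] power_add mult_ac)
  have "(\<Sum>f | f \<in> insert j I \<rightarrow>\<^sub>E UNIV \<and> inj_on f (insert j I). \<Prod>i\<in>insert j I. x (f i) ^ m i)
      = (\<Sum>f | f \<in> insert j I \<rightarrow>\<^sub>E UNIV \<and> inj_on f (insert j I). x (f j) ^ m j * ?P (restrict f I))"
    using assms by (intro sum.cong refl) simp
  also have "\<dots> = (\<Sum>f\<in>?A. \<Sum>v \<in> - f ` I. x v ^ m j * ?P f)"
    by (rule sum_inj_extend[OF assms, where g = "\<lambda>f v. x v ^ m j * ?P f"])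
  also have "\<dots> = (\<Sum>f\<in>?A. (\<Sum>v\<in>UNIV. x v ^ m j) * ?P f - (\<Sum>l\<in>I. x (f l) ^ m j * ?P f))"
  proof (rule sum.cong[OF refl])
    fix f assume "f \<in> ?A"
    then have "(\<Sum>l\<in>I. x (f l) ^ m j) = (\<Sum>v \<in> f ` I. x v ^ m j)"
      by (simp add: sum.reindex)
    then have "(\<Sum>v \<in> - f ` I. x v ^ m j) = (\<Sum>v\<in>UNIV. x v ^ m j) - (\<Sum>l\<in>I. x (f l) ^ m j)"
      by (simp add: Compl_eq_Diff_UNIV sum_diff)
    then show "(\<Sum>v \<in> - f ` I. x v ^ m j * ?P f) =
        (\<Sum>v\<in>UNIV. x v ^ m j) * ?P f - (\<Sum>l\<in>I. x (f l) ^ m j * ?P f)"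
      by (simp add: left_diff_distrib flip: sum_distrib_right)
  qed
  also have "\<dots> = (\<Sum>v\<in>UNIV. x v ^ m j) * (\<Sum>f\<in>?A. ?P f) -
      (\<Sum>l\<in>I. \<Sum>f\<in>?A. x (f l) ^ m j * ?P f)"
    by (simp add: sum_subtractf sum_distrib_left sum.swap[of _ I])
  also have "\<dots> = (\<Sum>v\<in>UNIV. x v ^ m j) * (\<Sum>f\<in>?A. ?P f) -
      (\<Sum>l\<in>I. \<Sum>f\<in>?A. \<Prod>i\<in>I. x (f i) ^ (m(l := m l + m j)) i)"
    using merge by simp
  finally show ?thesis .
qed

text \<open>The recursion on \<open>I\<close> reaches only power sums of exponent at most
  \<open>d\<close>: merging two exponents preserves the total, and each single exponent is bounded
  by it. Exponents change along the way, so the induction runs over all \<open>m\<close>.\<close>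

lemma inj_monomial_sum_cong:
  fixes x y :: "'b::finite \<Rightarrow> 'c::comm_ring_1"
  assumes "finite I"
    and "\<And>k. k \<le> d \<Longrightarrow> (\<Sum>i\<in>UNIV. x i ^ k) = (\<Sum>i\<in>UNIV. y i ^ k)"
    and "sum m I \<le> d"
  shows "(\<Sum>f | f \<in> I \<rightarrow>\<^sub>E UNIV \<and> inj_on f I. \<Prod>i\<in>I. x (f i) ^ m i) =
    (\<Sum>f | f \<in> I \<rightarrow>\<^sub>E UNIV \<and> inj_on f I. \<Prod>i\<in>I. y (f i) ^ m i)"
  using assms(1,3)
proof (induction I arbitrary: m rule: finite_induct)
  case empty
  then show ?case by simp
next
  case (insert j I)
  have "sum (m(l := m l + m j)) I \<le> d" if "l \<in> I" for l
    using insert.prems insert.hyps that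
    by (simp add: sum.remove[of I l])
  moreover have "sum m I \<le> d" and "m j \<le> d"
    using insert.prems insert.hyps by auto
  ultimately show ?case
    unfolding inj_monomial_sum_insert[OF insert.hyps]
    using insert.IH assms(2) by (simp cong: sum.cong)
qed

section \<open>Values of symmetric polynomials are determined by power sums\<close>

lemma Var_power: "(Var j :: ('n, 'c::comm_semiring_1) mpoly) ^ k = Poly_Mapping.single (Poly_Mapping.single j k) 1"
  by (induction k) (simp_all add: Var_def mult_single flip: single_add)

lemma prod_single_one:
  "finite A \<Longrightarrow> (\<Prod>i\<in>A. Poly_Mapping.single (a i) (1 :: 'c::comm_semiring_1)) = Poly_Mapping.single (sum a A) 1"
  by (induction A rule: finite_induct) (simp_all add: mult_single)

text \<open>Passes from the formal identity to invariance of the polynomial function: symmetry says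
  that coefficients are constant along the action \<open>r\<close> of \<open>\<sigma>\<close> on
  exponent vectors, and then the sum over monomials can be reindexed by \<open>r\<close>.\<close>

lemma symmetric_mpoly_eval_permute:
  fixes F :: "('n::finite, real) mpoly"
  assumes "symmetric_mpoly F" and \<sigma>: "\<sigma> permutes UNIV"
  shows "mpoly_eval F (\<chi> i. x $ \<sigma> i) = mpoly_eval F x"
proof -
  define r :: "('n \<Rightarrow>\<^sub>0 nat) \<Rightarrow> ('n \<Rightarrow>\<^sub>0 nat)"
    where "r m = (\<Sum>i\<in>UNIV. Poly_Mapping.single (\<sigma> i) (Poly_Mapping.lookup m i))" for m
  have inj: "inj \<sigma>"
    using \<sigma> by (rule permutes_inj)
  have lookup_r: "Poly_Mapping.lookup (r m) (\<sigma> i) = Poly_Mapping.lookup m i" for m i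
    by (simp add: r_def lookup_sum lookup_single when_def inj_eq[OF inj])
  have inj_r: "inj r"
    by (rule injI, rule poly_mapping_eqI) (metis lookup_r)
  have F: "F = (\<Sum>m\<in>Poly_Mapping.keys F. Poly_Mapping.single (r m) (Poly_Mapping.lookup F m))"
    using assms unfolding symmetric_mpoly_def mpoly_subst_def
    by (simp add: Var_power prod_single_one Const_def mult_single r_def)
  have F_r: "Poly_Mapping.lookup F (r m) = Poly_Mapping.lookup F m" for m
    using arg_cong[OF F, of "\<lambda>G. Poly_Mapping.lookup G (r m)"]
    by (simp add: lookup_sum lookup_single when_def inj_eq[OF inj_r] in_keys_iff split: if_splits)
  \<comment> \<open>An injective map of a finite set into itself is onto, so \<open>r\<close>
    permutes the monomials of \<open>F\<close>.\<close>
  have "r ` Poly_Mapping.keys F = Poly_Mapping.keys F"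
    by (rule endo_inj_surj) (auto simp: F_r in_keys_iff intro: inj_on_subset[OF inj_r])
  then have "mpoly_eval F x = (\<Sum>m \<in> r ` Poly_Mapping.keys F.
      Poly_Mapping.lookup F m * (\<Prod>i\<in>UNIV. x $ i ^ Poly_Mapping.lookup m i))"
    by (simp add: mpoly_eval_def mpoly_subst_def)
  also have "\<dots> = (\<Sum>m \<in> Poly_Mapping.keys F.
      Poly_Mapping.lookup F m * (\<Prod>i\<in>UNIV. x $ i ^ Poly_Mapping.lookup (r m) i))"
    by (subst sum.reindex) (auto simp: F_r intro: inj_on_subset[OF inj_r])
  also have "\<dots> = (\<Sum>m \<in> Poly_Mapping.keys F.
      Poly_Mapping.lookup F m * (\<Prod>i\<in>UNIV. x $ \<sigma> i ^ Poly_Mapping.lookup m i))"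
    by (subst prod.permute[OF \<sigma>]) (simp add: lookup_r)
  finally show ?thesis
    by (simp add: mpoly_eval_def mpoly_subst_def)
qed

lemma degree_le_total_degree:
  "m \<in> Poly_Mapping.keys F \<Longrightarrow> (\<Sum>i\<in>UNIV. Poly_Mapping.lookup m i) \<le> total_degree F"
  by (auto simp: total_degree_def)

text \<open>The average over all permutations turns each monomial of \<open>F\<close> into a sum
  over injections of the full index set, of total exponent at most the degree. The number of
  permutations is nonzero and cancels.\<close>

lemma symmetric_mpoly_eval_cong:
  fixes F :: "('n::finite, real) mpoly" and x y :: "real ^ 'n"
  assumes "symmetric_mpoly F"
    and power_sums: "\<And>k. k \<le> total_degree F \<Longrightarrow> (\<Sum>i\<in>UNIV. x $ i ^ k) = (\<Sum>i\<in>UNIV. y $ i ^ k)"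
  shows "mpoly_eval F x = mpoly_eval F y"
proof -
  let ?P = "{\<sigma> :: 'n \<Rightarrow> 'n. \<sigma> permutes UNIV}"
  have P: "?P = {f. f \<in> UNIV \<rightarrow>\<^sub>E UNIV \<and> inj_on f UNIV}"
    by (auto simp: permutes_inj intro!: bij_imp_permutes simp: bij_def finite_UNIV_inj_surj)
  have average: "of_nat (card ?P) * mpoly_eval F z = (\<Sum>m\<in>Poly_Mapping.keys F. Poly_Mapping.lookup F m *
      (\<Sum>\<sigma>\<in>?P. \<Prod>i\<in>UNIV. z $ \<sigma> i ^ Poly_Mapping.lookup m i))" for z
  proof -
    have "of_nat (card ?P) * mpoly_eval F z = (\<Sum>\<sigma>\<in>?P. mpoly_eval F (\<chi> i. z $ \<sigma> i))"
      using symmetric_mpoly_eval_permute[OF assms(1)] by simp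
    also have "\<dots> = (\<Sum>m\<in>Poly_Mapping.keys F. Poly_Mapping.lookup F m *
        (\<Sum>\<sigma>\<in>?P. \<Prod>i\<in>UNIV. z $ \<sigma> i ^ Poly_Mapping.lookup m i))"
      by (simp add: mpoly_eval_def mpoly_subst_def sum_distrib_left sum.swap[of _ ?P])
    finally show ?thesis .
  qed
  have "of_nat (card ?P) * mpoly_eval F x = of_nat (card ?P) * mpoly_eval F y"
    unfolding average unfolding P
    by (intro sum.cong refl arg_cong2[where f = times]
          inj_monomial_sum_cong[OF finite power_sums degree_le_total_degree])
  then show ?thesis
    by (simp add: card_permutations)
qed

section \<open>Power sums through formal power series\<close>

text \<open>The Newton identities: \<open>- E' / E\<close> is the generating function of the power sums, where
  \<open>E = (\<Prod>i\<in>A. 1 - x\<^sub>i X)\<close>.\<close>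

lemma fps_deriv_prod_linear:
  fixes x :: "'a \<Rightarrow> 'c::comm_ring_1"
  assumes "finite A"
  shows "fps_deriv (\<Prod>i\<in>A. 1 - fps_const (x i) * fps_X) =
    - (\<Prod>i\<in>A. 1 - fps_const (x i) * fps_X) * Abs_fps (\<lambda>k. \<Sum>i\<in>A. x i ^ Suc k)"
  using assms
proof (induction A rule: finite_induct)
  case empty
  have "Abs_fps (\<lambda>k. 0 :: 'c) = 0"
    by (rule fps_ext) simp
  then show ?case by simp
next
  case (insert j A)
  let ?E = "\<Prod>i\<in>A. 1 - fps_const (x i) * fps_X"
    and ?G = "Abs_fps (\<lambda>k. x j ^ Suc k)" and ?l = "1 - fps_const (x j) * fps_X"
  \<comment> \<open>The geometric series of \<open>x j\<close>, which is the contribution of the new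
    index to \<open>- E' / E\<close>.\<close>
  have geometric: "?l * ?G = fps_const (x j)"
    by (rule fps_ext) (auto simp: algebra_simps fps_X_mult_nth simp flip: power_Suc)
  have sum: "Abs_fps (\<lambda>k. \<Sum>i\<in>insert j A. x i ^ Suc k) = ?G + Abs_fps (\<lambda>k. \<Sum>i\<in>A. x i ^ Suc k)"
    using insert.hyps by (auto intro!: fps_ext)
  have "fps_deriv (\<Prod>i\<in>insert j A. 1 - fps_const (x i) * fps_X)
      = - fps_const (x j) * ?E + ?l * (- ?E * Abs_fps (\<lambda>k. \<Sum>i\<in>A. x i ^ Suc k))"
    using insert by (simp add: algebra_simps del: fps_const_neg)
  also have "\<dots> = - (?l * ?E) * Abs_fps (\<lambda>k. \<Sum>i\<in>insert j A. x i ^ Suc k)"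
  proof -
    have "- c * e + l * (- e * p) = - (l * e) * (g + p)" if "l * g = c" for c e l g p :: "'c fps"
      unfolding that[symmetric] by (simp add: algebra_simps)
    then show ?thesis
      using geometric unfolding sum by blast
  qed
  finally show ?case
    using insert.hyps by simp
qed

text \<open>Differentiating \<open>E\<close> and eliminating \<open>?E x\<close> gives
  \<open>?E y * (?P y - ?P x) = fps_X ^ d * ?R\<close>. Since \<open>?E y\<close> has constant term
  1, it is invertible, so the two power sum series agree below order \<open>d\<close> and first
  differ by the constant term of \<open>?R\<close>.\<close>

lemma power_sums_of_prod_linear:
  fixes x y :: "'a \<Rightarrow> 'c::field"
  assumes "finite A"
    and E: "(\<Prod>i\<in>A. 1 - fps_const (y i) * fps_X) =
      (\<Prod>i\<in>A. 1 - fps_const (x i) * fps_X) + fps_X ^ Suc d * H"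
  shows "k \<le> d \<Longrightarrow> (\<Sum>i\<in>A. y i ^ k) = (\<Sum>i\<in>A. x i ^ k)"
    and "(\<Sum>i\<in>A. y i ^ Suc d) = (\<Sum>i\<in>A. x i ^ Suc d) - of_nat (Suc d) * fps_nth H 0"
proof -
  let ?E = "\<lambda>x. \<Prod>i\<in>A. 1 - fps_const (x i) * fps_X" and ?P = "\<lambda>x. Abs_fps (\<lambda>k. \<Sum>i\<in>A. x i ^ Suc k)"
  let ?R = "- (of_nat (Suc d) * H) - fps_X * fps_deriv H - fps_X * H * ?P x"
  have E0: "fps_nth (?E x) 0 = 1" for x :: "'a \<Rightarrow> 'c"
    using assms(1) by (induction A rule: finite_induct) simp_all
  then have inv: "?E y * inverse (?E y) = 1"
    by (metis inverse_mult_eq_1' zero_neq_one)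
  have X: "fps_X ^ Suc d = (fps_X ^ d * fps_X :: 'c fps)"
    by (rule power_Suc2)
  have "fps_deriv (fps_X ^ Suc d) = of_nat (Suc d) * (fps_X ^ d :: 'c fps)"
    by (simp add: fps_deriv_power fps_of_nat del: of_nat_Suc power_Suc)
  then have deriv: "fps_deriv (fps_X ^ Suc d * H) = fps_X ^ d * (of_nat (Suc d) * H + fps_X * fps_deriv H)"
    unfolding fps_deriv_mult by (simp add: algebra_simps del: of_nat_Suc)
  have "- ?E y * ?P y = - (?E y - fps_X ^ d * fps_X * H) * ?P x +
      fps_X ^ d * (of_nat (Suc d) * H + fps_X * fps_deriv H)"
  proof -
    have "?E x = ?E y - fps_X ^ d * fps_X * H"
      using E unfolding X by (simp only: add_diff_cancel_right')
    moreover have "- ?E y * ?P y = - ?E x * ?P x + fps_X ^ d * (of_nat (Suc d) * H + fps_X * fps_deriv H)"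
      using arg_cong[OF E, of fps_deriv]
      by (simp only: fps_deriv_add fps_deriv_prod_linear[OF assms(1)] deriv)
    ultimately show ?thesis
      by (simp only:)
  qed
  moreover have "e * (p - q) = X * r"
    if "- e * p = - (e - X * t * h) * q + X * (n * h + t * h')" and "r = - (n * h) - t * h' - t * h * q"
    for e p q X t h n h' r :: "'c fps"
    unfolding that(2) using that(1) by (simp add: algebra_simps)
  ultimately have "?E y * (?P y - ?P x) = fps_X ^ d * ?R"
    by blast
  moreover have "a = b * (r * i)" if "e * a = b * r" and "e * i = 1" for a b r e i :: "'c fps"
    using that by (metis mult.assoc mult.commute mult_1)
  ultimately have "?P y - ?P x = fps_X ^ d * (?R * inverse (?E y))"
    using inv by blast
  \<comment> \<open>Coefficient \<open>k\<close> belongs to the exponent \<open>Suc k\<close>, so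
    order \<open>d\<close> concerns the power sum of exponent \<open>Suc d\<close>. Exponent 0
    merely counts \<open>A\<close>.\<close>
  then have P: "(\<Sum>i\<in>A. y i ^ Suc k) - (\<Sum>i\<in>A. x i ^ Suc k) =
      (if k < d then 0 else fps_nth (?R * inverse (?E y)) (k - d))" for k
    by (auto simp only: fps_eq_iff fps_X_power_mult_nth fps_sub_nth fps_nth_Abs_fps)
  show "(\<Sum>i\<in>A. y i ^ k) = (\<Sum>i\<in>A. x i ^ k)" if "k \<le> d"
    using P[of "k - 1"] that by (cases k) auto
  have "fps_nth (?R * inverse (?E y)) 0 = - (of_nat (Suc d) * fps_nth H 0)"
    using E0[of y] by (simp add: fps_of_nat[symmetric] del: of_nat_Suc)
  then show "(\<Sum>i\<in>A. y i ^ Suc d) = (\<Sum>i\<in>A. x i ^ Suc d) - of_nat (Suc d) * fps_nth H 0"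
    using P[of d] by (simp add: algebra_simps)
qed

section \<open>Perturbing polynomials with simple real roots\<close>

text \<open>The product changes sign across each of its simple roots. Strict sign changes at
  finitely many points survive a small perturbation, so the intermediate value theorem yields a new
  root \<open>b a\<close> near each \<open>a\<close>. The degree bound on \<open>h\<close> keeps the
  polynomial monic, so these roots determine it.\<close>

lemma prod_linear_perturbation:
  fixes S :: "real set" and h :: "real poly"
  assumes "finite S" and "degree h < card S"
  shows "\<exists>\<epsilon><0. \<exists>b. (\<Prod>a\<in>S. [:- b a, 1:]) = (\<Prod>a\<in>S. [:- a, 1:]) + smult \<epsilon> h"
proof -
  define q where "q = (\<Prod>a\<in>S. [:- a, 1:])"
  \<comment> \<open>For such \<open>\<delta>\<close> the intervals of radius \<open>\<delta>\<close>
    around the points of \<open>S\<close> are disjoint, which later makes the new roots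
    distinct.\<close>
  have "\<forall>\<^sub>F \<delta> in at_right 0. \<forall>a\<in>S. \<forall>b\<in>S. a \<noteq> b \<longrightarrow> 2 * \<delta> < \<bar>a - b\<bar>"
  proof (intro eventually_ball_finite ballI assms(1))
    fix a b :: real
    show "\<forall>\<^sub>F \<delta> in at_right 0. a \<noteq> b \<longrightarrow> 2 * \<delta> < \<bar>a - b\<bar>"
    proof (cases "a = b")
      case False
      have "((\<lambda>\<delta>. 2 * \<delta>) \<longlongrightarrow> 2 * 0) (at_right (0::real))"
        by (intro tendsto_intros)
      then show ?thesis
        using order_tendstoD(2)[of _ "2 * 0" _ "\<bar>a - b\<bar>"] False by simp
    qed simp
  qed
  then have "\<forall>\<^sub>F \<delta> in at_right 0. 0 < \<delta> \<and> (\<forall>a\<in>S. \<forall>b\<in>S. a \<noteq> b \<longrightarrow> 2 * \<delta> < \<bar>a - b\<bar>)"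
    by (intro eventually_conj eventually_at_right_less)
  then obtain \<delta> where "\<delta> > 0" and gap: "\<And>a b. a \<in> S \<Longrightarrow> b \<in> S \<Longrightarrow> a \<noteq> b \<Longrightarrow> 2 * \<delta> < \<bar>a - b\<bar>"
    using eventually_happens'[OF trivial_limit_at_right_real] by blast
  have q_sign: "poly q (a - \<delta>) * poly q (a + \<delta>) < 0" if "a \<in> S" for a
  proof -
    \<comment> \<open>Pairing the two factors of each root \<open>c\<close> gives a difference of
      squares, which is negative only for \<open>c = a\<close>.\<close>
    have "poly q (a - \<delta>) * poly q (a + \<delta>) = (\<Prod>c\<in>S. (a - c)\<^sup>2 - \<delta>\<^sup>2)"
      by (simp add: q_def poly_prod power2_eq_square algebra_simps flip: prod.distrib)
    also have "\<dots> = - \<delta>\<^sup>2 * (\<Prod>c\<in>S - {a}. (a - c)\<^sup>2 - \<delta>\<^sup>2)"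
      using assms(1) that by (simp add: prod.remove)
    also have "\<dots> < 0"
    proof -
      have "0 < (\<Prod>c\<in>S - {a}. (a - c)\<^sup>2 - \<delta>\<^sup>2)"
      proof (rule prod_pos)
        fix c assume "c \<in> S - {a}"
        then have "\<bar>\<delta>\<bar> < \<bar>a - c\<bar>"
          using gap[of a c] that \<open>\<delta> > 0\<close> by auto
        then show "0 < (a - c)\<^sup>2 - \<delta>\<^sup>2"
          by (metis abs_le_square_iff diff_gt_0_iff_gt not_le)
      qed
      then show ?thesis
        using \<open>\<delta> > 0\<close> by (simp add: mult_less_0_iff)
    qed
    finally show ?thesis .
  qed
  have "\<forall>\<^sub>F \<epsilon> in at_left 0. \<forall>a\<in>S. poly (q + smult \<epsilon> h) (a - \<delta>) * poly (q + smult \<epsilon> h) (a + \<delta>) < 0"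
  proof (intro eventually_ball_finite ballI assms(1))
    fix a assume "a \<in> S"
    have "((\<lambda>\<epsilon>. poly (q + smult \<epsilon> h) (a - \<delta>) * poly (q + smult \<epsilon> h) (a + \<delta>)) \<longlongrightarrow>
        (poly q (a - \<delta>) + 0 * poly h (a - \<delta>)) * (poly q (a + \<delta>) + 0 * poly h (a + \<delta>))) (at_left 0)"
      by (simp only: poly_add poly_smult) (intro tendsto_intros)
    then show "\<forall>\<^sub>F \<epsilon> in at_left 0.
        poly (q + smult \<epsilon> h) (a - \<delta>) * poly (q + smult \<epsilon> h) (a + \<delta>) < 0"
      using q_sign[OF \<open>a \<in> S\<close>] by (intro order_tendstoD(2)) simp_all
  qed
  moreover have "\<forall>\<^sub>F \<epsilon> in at_left 0. \<epsilon> < (0::real)"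
    by (simp add: eventually_at_filter)
  ultimately have "\<forall>\<^sub>F \<epsilon> in at_left 0. \<epsilon> < 0 \<and>
      (\<forall>a\<in>S. poly (q + smult \<epsilon> h) (a - \<delta>) * poly (q + smult \<epsilon> h) (a + \<delta>) < 0)"
    by (intro eventually_conj)
  then obtain \<epsilon> where "\<epsilon> < 0" and sign:
    "\<And>a. a \<in> S \<Longrightarrow> poly (q + smult \<epsilon> h) (a - \<delta>) * poly (q + smult \<epsilon> h) (a + \<delta>) < 0"
    using eventually_happens'[OF trivial_limit_at_left_real] by blast
  have "\<exists>r. \<bar>r - a\<bar> < \<delta> \<and> poly (q + smult \<epsilon> h) r = 0" if a: "a \<in> S" for a
  proof -
    obtain r where "a - \<delta> < r" "r < a + \<delta>" "poly (q + smult \<epsilon> h) r = 0"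
      using poly_IVT[OF _ sign[OF a]] \<open>\<delta> > 0\<close> by force
    then show ?thesis
      by (intro exI[of _ r]) auto
  qed
  then obtain b where b: "\<And>a. a \<in> S \<Longrightarrow> \<bar>b a - a\<bar> < \<delta>"
    and root: "\<And>a. a \<in> S \<Longrightarrow> poly (q + smult \<epsilon> h) (b a) = 0"
    by metis
  have "inj_on b S"
  proof (rule inj_onI, rule ccontr)
    fix a c assume "a \<in> S" "c \<in> S" "b a = b c" "a \<noteq> c"
    then show False
      using gap[of a c] b[of a] b[of c] by auto
  qed
  have degree: "degree (\<Prod>a\<in>S. [:- f a, 1:]) = card S"
    for f :: "real \<Rightarrow> real"
    by (simp add: degree_prod_eq_sum_degree)
  have monic: "lead_coeff (\<Prod>a\<in>S. [:- f a, 1:]) = 1" for f :: "real \<Rightarrow> real"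
    unfolding lead_coeff_prod by simp
  \<comment> \<open>Both sides have degree at most \<open>card S\<close>, the same coefficient
    there, and equal values at the \<open>card S\<close> distinct points \<open>b a\<close>.\<close>
  have "(\<Prod>a\<in>S. [:- b a, 1:]) = q + smult \<epsilon> h"
  proof (rule poly_eqI_degree_lead_coeff[where n = "card S" and A = "b ` S"])
    show "coeff (\<Prod>a\<in>S. [:- b a, 1:]) (card S) = coeff (q + smult \<epsilon> h) (card S)"
      using degree[of b] monic[of b] degree[of "\<lambda>a. a"] monic[of "\<lambda>a. a"] assms(2)
      by (simp add: q_def coeff_eq_0)
    show "degree (q + smult \<epsilon> h) \<le> card S"
      using degree[of "\<lambda>a. a"] assms(2) by (intro degree_add_le) (simp_all add: q_def)
    show "poly (\<Prod>a\<in>S. [:- b a, 1:]) z = poly (q + smult \<epsilon> h) z" if "z \<in> b ` S" for z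
      using that root assms(1) by (auto simp: poly_prod)
  qed (use degree[of b] \<open>inj_on b S\<close> in \<open>simp_all add: card_image\<close>)
  then show ?thesis
    using \<open>\<epsilon> < 0\<close> unfolding q_def by blast
qed

text \<open>Passing to reciprocal polynomials, \<open>t ^ card S\<close> times the value at
  \<open>1 / t\<close>, turns root factors into the factors of the generating function and sends the
  exponent \<open>card S - Suc d\<close> to \<open>Suc d\<close>.\<close>

lemma prod_linear_reverse:
  fixes b :: "real \<Rightarrow> real"
  assumes "finite S" and "d < card S"
    and eq: "(\<Prod>a\<in>S. [:- b a, 1:]) = (\<Prod>a\<in>S. [:- a, 1:]) + smult \<epsilon> (monom 1 (card S - Suc d))"
  shows "(\<Prod>a\<in>S. [:1, - b a:]) = (\<Prod>a\<in>S. [:1, - a:]) + monom \<epsilon> (Suc d)"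
proof -
  have reverse: "poly (\<Prod>a\<in>S. [:1, - f a:]) t = t ^ card S * poly (\<Prod>a\<in>S. [:- f a, 1:]) (1 / t)"
    if "t \<noteq> 0" for f :: "real \<Rightarrow> real" and t
  proof -
    have "poly (\<Prod>a\<in>S. [:1, - f a:]) t = (\<Prod>a\<in>S. t * poly [:- f a, 1:] (1 / t))"
      using that by (simp add: poly_prod algebra_simps)
    then show ?thesis
      by (simp add: poly_prod prod.distrib)
  qed
  \<comment> \<open>The extra factor \<open>[:0, 1:]\<close> makes both sides vanish at 0, where
    \<open>1 / t\<close> gives no information; it is cancelled at the end.\<close>
  have "poly ([:0, 1:] * (\<Prod>a\<in>S. [:1, - b a:])) t =
      poly ([:0, 1:] * ((\<Prod>a\<in>S. [:1, - a:]) + monom \<epsilon> (Suc d))) t" for t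
  proof (cases "t = 0")
    case False
    have "t ^ card S = t ^ Suc d * t ^ (card S - Suc d)"
      using assms(2) by (simp flip: power_add del: power_Suc)
    then have "t ^ card S * (\<epsilon> * (1 / t) ^ (card S - Suc d)) = \<epsilon> * t ^ Suc d"
      using False by (simp add: power_one_over)
    then show ?thesis
      using reverse[OF False, of b] reverse[OF False, of "\<lambda>a. a"] False
      by (simp add: eq poly_monom algebra_simps)
  qed simp
  then have "[:0, 1:] * (\<Prod>a\<in>S. [:1, - b a:]) = [:0, 1:] * ((\<Prod>a\<in>S. [:1, - a:]) + monom \<epsilon> (Suc d))"
    by (intro poly_eq_poly_eq_iff[THEN iffD1] ext)
  then show ?thesis
    by simp
qed

section \<open>Maximising the next power sum on a compact set\<close>

lemma power_sum_increasable:
  fixes z :: "real ^ 'n"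
  assumes "d < num_distinct z"
  shows "\<exists>y :: real ^ 'n. (\<forall>k\<le>d. (\<Sum>i\<in>UNIV. y $ i ^ k) = (\<Sum>i\<in>UNIV. z $ i ^ k)) \<and>
    (\<Sum>i\<in>UNIV. y $ i ^ Suc d) > (\<Sum>i\<in>UNIV. z $ i ^ Suc d)"
proof -
  define S where "S = range (($) z)"
  have "{z $ i | i. i \<in> UNIV} = S"
    by (auto simp: S_def)
  then have "finite S" and card: "d < card S"
    using assms by (simp_all add: S_def num_distinct_def)
  then obtain \<epsilon> b where "\<epsilon> < 0" and
    "(\<Prod>a\<in>S. [:- b a, 1:]) = (\<Prod>a\<in>S. [:- a, 1:]) + smult \<epsilon> (monom 1 (card S - Suc d))"
    using prod_linear_perturbation[of S "monom 1 (card S - Suc d)"] by (auto simp: degree_monom_eq)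
  then have b: "(\<Prod>a\<in>S. [:1, - b a:]) = (\<Prod>a\<in>S. [:1, - a:]) + monom \<epsilon> (Suc d)"
    using prod_linear_reverse[OF \<open>finite S\<close> card] by blast
  \<comment> \<open>\<open>J\<close> holds exactly one index for each distinct component. Only these
    indices move, so the remaining factors \<open>?R\<close> are common to \<open>y\<close> and
    \<open>z\<close>.\<close>
  define J where "J = inv (($) z) ` S"
  define y where "y = (\<chi> i. if i \<in> J then b (z $ i) else z $ i)"
  have z_inv: "z $ inv (($) z) a = a" if "a \<in> S" for a
    using that f_inv_into_f[of a "($) z" UNIV] by (simp add: S_def)
  have "inj_on (inv (($) z)) S"
    by (rule inj_on_inverseI[of _ "($) z"]) (rule z_inv)
  then have J: "(\<Prod>i\<in>J. [:1, - f (z $ i):]) = (\<Prod>a\<in>S. [:1, - f a:])" for f :: "real \<Rightarrow> real"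
    by (simp add: J_def prod.reindex z_inv)
  have split: "(\<Prod>i\<in>UNIV. g i) = (\<Prod>i\<in>J. g i) * (\<Prod>i\<in>- J. g i)" for g :: "'n \<Rightarrow> real poly"
    using prod.union_disjoint[of J "- J" g] by simp
  let ?R = "\<Prod>i\<in>- J. [:1, - (z $ i):]"
  have "(\<Prod>i\<in>UNIV. [:1, - (y $ i):]) = (\<Prod>i\<in>J. [:1, - b (z $ i):]) * ?R"
    unfolding split by (auto simp: y_def intro!: arg_cong2[where f = times] prod.cong)
  also have "\<dots> = (\<Prod>i\<in>UNIV. [:1, - (z $ i):]) + monom 1 (Suc d) * smult \<epsilon> ?R"
    unfolding split[of "\<lambda>i. [:1, - (z $ i):]"] J[of b] J[of "\<lambda>a. a"] b
    by (simp add: algebra_simps smult_monom flip: mult_smult_left)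
  finally have "fps_of_poly (\<Prod>i\<in>UNIV. [:1, - (y $ i):]) =
      fps_of_poly (\<Prod>i\<in>UNIV. [:1, - (z $ i):]) + fps_X ^ Suc d * fps_of_poly (smult \<epsilon> ?R)"
    by (simp only: fps_of_poly_add fps_of_poly_mult fps_of_poly_monom')
  moreover have "fps_of_poly [:1, - a:] = 1 - fps_const a * fps_X" for a :: real
    by (simp add: fps_of_poly_linear' flip: fps_const_neg)
  ultimately have E: "(\<Prod>i\<in>UNIV. 1 - fps_const (y $ i) * fps_X) =
      (\<Prod>i\<in>UNIV. 1 - fps_const (z $ i) * fps_X) + fps_X ^ Suc d * fps_of_poly (smult \<epsilon> ?R)"
    by (simp only: fps_of_poly_prod)
  \<comment> \<open>Every factor of \<open>?R\<close> is 1 at 0. The power sum of exponent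
    \<open>Suc d\<close> thus changes by \<open>- (Suc d) * \<epsilon>\<close>, positive because
    \<open>\<epsilon>\<close> is negative.\<close>
  have "fps_nth (fps_of_poly (smult \<epsilon> ?R)) 0 = \<epsilon>"
    by (simp add: poly_prod flip: poly_0_coeff_0)
  then have "(\<Sum>i\<in>UNIV. y $ i ^ Suc d) > (\<Sum>i\<in>UNIV. z $ i ^ Suc d)"
    unfolding power_sums_of_prod_linear(2)[OF finite E] using \<open>\<epsilon> < 0\<close>
    by (simp add: mult_less_0_iff del: of_nat_Suc)
  then show ?thesis
    using power_sums_of_prod_linear(1)[OF finite E] by blast
qed

lemma exists_few_distinct_same_power_sums:
  fixes x :: "real ^ 'n"
  assumes "d > 0"
  shows "\<exists>y :: real ^ 'n. num_distinct y \<le> d \<and> (\<forall>k\<le>d. (\<Sum>i\<in>UNIV. y $ i ^ k) = (\<Sum>i\<in>UNIV. x $ i ^ k))"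
proof (cases "d = 1")
  case True
  \<comment> \<open>The case \<open>d = 1\<close> is separate because fixing only the sum does not
    bound the vector in general; the constant vector at the mean works directly.\<close>
  define y :: "real ^ 'n" where "y = (\<chi> i. (\<Sum>i\<in>UNIV. x $ i) / CARD('n))"
  have "num_distinct y = 1"
    by (simp add: num_distinct_def y_def)
  moreover have "(\<Sum>i\<in>UNIV. y $ i ^ k) = (\<Sum>i\<in>UNIV. x $ i ^ k)" if "k \<le> 1" for k
    using that by (cases k) (simp_all add: y_def)
  ultimately show ?thesis
    using True by (intro exI[of _ y]) simp
next
  case False
  then have "2 \<le> d"
    using assms by simp
  define K where "K = {z :: real ^ 'n. \<forall>k\<le>d. (\<Sum>i\<in>UNIV. z $ i ^ k) = (\<Sum>i\<in>UNIV. x $ i ^ k)}"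
  have "closed K"
    unfolding K_def by (intro closed_Collect_all closed_Collect_imp closed_Collect_eq continuous_intros) simp_all
  \<comment> \<open>As \<open>2 \<le> d\<close>, the sum of squares is among the fixed power sums,
    so \<open>K\<close> lies on a sphere.\<close>
  moreover have "norm z = norm x" if "z \<in> K" for z
    using that \<open>2 \<le> d\<close> by (simp add: K_def norm_vec_def L2_set_def)
  then have "bounded K"
    by (auto intro!: boundedI[of K "norm x"])
  ultimately have "compact K"
    by (simp add: compact_eq_bounded_closed)
  moreover have "K \<noteq> {}"
    by (auto simp: K_def)
  moreover have "continuous_on K (\<lambda>z. \<Sum>i\<in>UNIV. z $ i ^ Suc d)"
    by (intro continuous_intros)
  ultimately obtain z where "z \<in> K"
    and max: "\<And>y. y \<in> K \<Longrightarrow> (\<Sum>i\<in>UNIV. y $ i ^ Suc d) \<le> (\<Sum>i\<in>UNIV. z $ i ^ Suc d)"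
    using continuous_attains_sup[of K "\<lambda>z. \<Sum>i\<in>UNIV. z $ i ^ Suc d"] by blast
  have "\<not> d < num_distinct z"
  proof
    assume "d < num_distinct z"
    then obtain y :: "real ^ 'n"
      where "\<forall>k\<le>d. (\<Sum>i\<in>UNIV. y $ i ^ k) = (\<Sum>i\<in>UNIV. z $ i ^ k)"
        and "(\<Sum>i\<in>UNIV. y $ i ^ Suc d) > (\<Sum>i\<in>UNIV. z $ i ^ Suc d)"
      using power_sum_increasable by blast
    then show False
      using max[of y] \<open>z \<in> K\<close> by (simp add: K_def not_le)
  qed
  then show ?thesis
    using \<open>z \<in> K\<close> unfolding K_def by (intro exI[of _ z]) simp
qed

theorem theorem1p1:
  fixes F :: "('n::finite, real) mpoly" and d :: nat
  assumes "symmetric_mpoly F" and "F \<noteq> 0" and "total_degree F = d"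
  shows "(\<exists>x :: real ^ 'n. mpoly_eval F x = 0) \<longleftrightarrow> (\<exists>y \<in> (A_set d :: (real ^ 'n) set). mpoly_eval F y = 0)"
proof
  assume "\<exists>x :: real ^ 'n. mpoly_eval F x = 0"
  then obtain x :: "real ^ 'n" where x: "mpoly_eval F x = 0"
    by blast
  \<comment> \<open>A nonzero polynomial of degree 0 is a nonzero constant and has no zero. This
    case must be excluded since every vector has at least one component, so \<open>A_set 0\<close>
    is empty.\<close>
  have "d > 0"
  proof (rule ccontr)
    assume "\<not> d > 0"
    then have "Poly_Mapping.keys F \<subseteq> {0}"
      using degree_le_total_degree[of _ F] assms(3)
      by (fastforce intro: poly_mapping_eqI)
    then have keys: "Poly_Mapping.keys F = {0}"
      using assms(2) by (metis keys_eq_empty subset_singletonD)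
    then have "Poly_Mapping.lookup F 0 \<noteq> 0"
      by (simp flip: in_keys_iff)
    then show False
      using x keys by (simp add: mpoly_eval_def mpoly_subst_def)
  qed
  then obtain y :: "real ^ 'n" where "num_distinct y \<le> d"
    and "\<forall>k\<le>d. (\<Sum>i\<in>UNIV. y $ i ^ k) = (\<Sum>i\<in>UNIV. x $ i ^ k)"
    using exists_few_distinct_same_power_sums by blast
  then have "y \<in> A_set d" and "mpoly_eval F y = mpoly_eval F x"
    using symmetric_mpoly_eval_cong[OF assms(1), of y x] assms(3) by (simp_all add: A_set_def)
  with x show "\<exists>y \<in> (A_set d :: (real ^ 'n) set). mpoly_eval F y = 0"
    by auto
qed blast

end
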